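(* Let $G$ be a finite cyclic group of order $n$, with a fixed generator $\tau$. Let $R$ be a commutative ring with unit equipped with a ring homomorphism $\mathbb{Z}[\zeta_n]\to R$, where $\zeta_n$ is a primitive complex $n$-th root of unity; write $\zeta_n$ also for its image in $R$. Let $\chi\colon G\to R^{\times}$ be the character with $\chi(\tau)=\zeta_n$. Let $M$ be a finite $R[G]$-module. For $0\le i\le n-1$ put $$\varepsilon_{\chi^i}=\sum_{\sigma\in G}\chi^{i}(\sigma)^{-1}\sigma\in R[G],\qquad M^{\chi^i}=\{m\in M:\ \sigma m=\chi^i(\sigma)m\ \text{for all }\sigma\in G\},$$ $$\widehat{H}^0_{\chi^i}(G,M)=M^{\chi^i}/\varepsilon_{\chi^i}M,\qquad S_{\chi^i}(M)=\Big(M^{\chi^i}\cap \prod_{j=i+1}^{n-1}(\tau-\zeta_n^{j})\,M\Big)\Big/\varepsilon_{\chi^i}M,$$ where the empty product (for $i=n-1$) is $1$. Then $$[M]\cdot\prod_{i=0}^{n-1}\big[\widehat{H}^0_{\chi^i}(G,M)/S_{\chi^i}(M)\big]=\prod_{i=0}^{n-1}[M^{\chi^i}],$$ equivalently $$[M]=\prod_{i=0}^{n-1}[\varepsilon_{\chi^i}M]\cdot\prod_{i=0}^{n-1}[S_{\chi^i}(M)].$$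
   Context: $[X]$ denotes the order (cardinality) of a finite set $X$. One has $\varepsilon_{\chi^i}M\subseteq M^{\chi^i}\cap\prod_{j=i+1}^{n-1}(\tau-\zeta_n^j)M$, so $S_{\chi^i}(M)$ is a submodule of $\widehat{H}^0_{\chi^i}(G,M)$. The characters $\chi^i$, $0\le i\le n-1$, are the $R$-valued characters of $G$; products are indexed by $i=0,\dots,n-1$. *)

theory Defs
  imports "HOL-Algebra.Algebra" "HOL-Algebra.Algebraic_Closure_Type"
begin

definition primitive_root_of_1 :: "nat \<Rightarrow> complex \<Rightarrow> bool" where
  "primitive_root_of_1 n z \<longleftrightarrow> 0 < n \<and> z ^ n = 1 \<and> (\<forall>k. 0 < k \<and> k < n \<longrightarrow> z ^ k \<noteq> 1)"

text \<open>The ring \<open>\<int>[z]\<close>, as the subring of the complex numbers generated by \<open>z\<close>.\<close>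

definition Z_adjoin :: "complex \<Rightarrow> complex ring" where
  "Z_adjoin z = (ring_of_type_algebra :: complex ring)
     \<lparr>carrier := generate_ring (ring_of_type_algebra :: complex ring) {z}\<rparr>"

text \<open>
  The group ring \<open>R[G]\<close> of a finite group \<open>G\<close>: the formal sum of all \<open>f \<sigma> \<cdot> \<sigma>\<close> is encoded as
  the coefficient function \<open>f\<close>, extended by \<open>undefined\<close> outside \<open>carrier G\<close>.
  (Finite support is automatic only because \<open>G\<close> is finite; the definition is not meant for
  infinite \<open>G\<close>.)
\<close>

definition group_ring ::
  "('r, 'c) ring_scheme \<Rightarrow> ('g, 'd) monoid_scheme \<Rightarrow> ('g \<Rightarrow> 'r) ring" where
  "group_ring R G =
     \<lparr>carrier = carrier G \<rightarrow>\<^sub>E carrier R,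
      monoid.mult = (\<lambda>f g. \<lambda>\<sigma>\<in>carrier G.
        \<Oplus>\<^bsub>R\<^esub>\<rho>\<in>carrier G. f \<rho> \<otimes>\<^bsub>R\<^esub> g (inv\<^bsub>G\<^esub> \<rho> \<otimes>\<^bsub>G\<^esub> \<sigma>)),
      one = (\<lambda>\<sigma>\<in>carrier G. if \<sigma> = \<one>\<^bsub>G\<^esub> then \<one>\<^bsub>R\<^esub> else \<zero>\<^bsub>R\<^esub>),
      ring.zero = (\<lambda>\<sigma>\<in>carrier G. \<zero>\<^bsub>R\<^esub>),
      add = (\<lambda>f g. \<lambda>\<sigma>\<in>carrier G. f \<sigma> \<oplus>\<^bsub>R\<^esub> g \<sigma>)\<rparr>"

lemma (in abelian_monoid) finsum_swap:
  assumes "finite A" "finite B" "\<And>x y. x \<in> A \<Longrightarrow> y \<in> B \<Longrightarrow> f x y \<in> carrier G"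
  shows "(\<Oplus>x\<in>A. \<Oplus>y\<in>B. f x y) = (\<Oplus>y\<in>B. \<Oplus>x\<in>A. f x y)"
  using assms(1,3)
proof (induction A rule: finite_induct)
  case empty
  then show ?case by (simp add: finsum_zero)
next
  case (insert a A)
  have 1: "(\<lambda>x. \<Oplus>y\<in>B. f x y) \<in> A \<rightarrow> carrier G" "(\<Oplus>y\<in>B. f a y) \<in> carrier G"
    using insert.prems by (auto intro!: finsum_closed)
  have 2: "(\<lambda>y. f a y) \<in> B \<rightarrow> carrier G" "(\<lambda>y. \<Oplus>x\<in>A. f x y) \<in> B \<rightarrow> carrier G"
    using insert.prems by (auto intro!: finsum_closed)
  have "(\<Oplus>x\<in>insert a A. \<Oplus>y\<in>B. f x y) = (\<Oplus>y\<in>B. f a y) \<oplus> (\<Oplus>y\<in>B. \<Oplus>x\<in>A. f x y)"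
    using insert 1 by (simp add: finsum_insert)
  also have "\<dots> = (\<Oplus>y\<in>B. f a y \<oplus> (\<Oplus>x\<in>A. f x y))"
    using finsum_addf[OF 2] by simp
  also have "\<dots> = (\<Oplus>y\<in>B. \<Oplus>x\<in>insert a A. f x y)"
    using insert 2 by (intro finsum_cong') (auto simp: finsum_insert intro!: finsum_closed)
  finally show ?case .
qed

lemma group_ring_cring:
  assumes "comm_group G" "finite (carrier G)" "cring R"
  shows "cring (group_ring R G)"
proof -
  interpret G: comm_group G by fact
  interpret R: cring R by fact
  let ?G = "carrier G"
  let ?A = "group_ring R G"
  note fin = assms(2)
  note defs = group_ring_def
  have app: "f \<sigma> \<in> carrier R" if "f \<in> carrier ?A" "\<sigma> \<in> ?G" for f \<sigma>
    using that by (auto simp: defs)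
  have ext: "f = g" if "f \<in> carrier ?A" "g \<in> carrier ?A" "\<And>\<sigma>. \<sigma> \<in> ?G \<Longrightarrow> f \<sigma> = g \<sigma>" for f g
    using that by (auto simp: defs intro: PiE_ext)
  have mult: "(f \<otimes>\<^bsub>?A\<^esub> g) \<sigma> = (\<Oplus>\<^bsub>R\<^esub>\<rho>\<in>?G. f \<rho> \<otimes>\<^bsub>R\<^esub> g (inv\<^bsub>G\<^esub> \<rho> \<otimes>\<^bsub>G\<^esub> \<sigma>))" if "\<sigma> \<in> ?G" for f g \<sigma>
    using that by (simp add: defs)
  have add: "(f \<oplus>\<^bsub>?A\<^esub> g) \<sigma> = f \<sigma> \<oplus>\<^bsub>R\<^esub> g \<sigma>" if "\<sigma> \<in> ?G" for f g \<sigma>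
    using that by (simp add: defs)
  have one: "\<one>\<^bsub>?A\<^esub> \<sigma> = (if \<sigma> = \<one>\<^bsub>G\<^esub> then \<one>\<^bsub>R\<^esub> else \<zero>\<^bsub>R\<^esub>)" if "\<sigma> \<in> ?G" for \<sigma>
    using that by (simp add: defs)
  have zero: "\<zero>\<^bsub>?A\<^esub> \<sigma> = \<zero>\<^bsub>R\<^esub>" if "\<sigma> \<in> ?G" for \<sigma>
    using that by (simp add: defs)
  have mc: "f \<otimes>\<^bsub>?A\<^esub> g \<in> carrier ?A" if "f \<in> carrier ?A" "g \<in> carrier ?A" for f g
  proof -
    have "(\<Oplus>\<^bsub>R\<^esub>\<rho>\<in>?G. f \<rho> \<otimes>\<^bsub>R\<^esub> g (inv\<^bsub>G\<^esub> \<rho> \<otimes>\<^bsub>G\<^esub> \<sigma>)) \<in> carrier R" if "\<sigma> \<in> ?G" for \<sigma>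
      by (intro R.finsum_closed Pi_I R.m_closed app G.m_closed G.inv_closed)
         (use that \<open>f \<in> _\<close> \<open>g \<in> _\<close> in auto)
    then show ?thesis by (auto simp: defs)
  qed
  have ac: "f \<oplus>\<^bsub>?A\<^esub> g \<in> carrier ?A" if "f \<in> carrier ?A" "g \<in> carrier ?A" for f g
    using that app[of f] app[of g] by (auto simp: defs)
  have oc: "\<one>\<^bsub>?A\<^esub> \<in> carrier ?A" and zc: "\<zero>\<^bsub>?A\<^esub> \<in> carrier ?A" by (auto simp: defs)
  have comm: "f \<otimes>\<^bsub>?A\<^esub> g = g \<otimes>\<^bsub>?A\<^esub> f" if fg: "f \<in> carrier ?A" "g \<in> carrier ?A" for f g
  proof (rule ext)
    fix \<sigma> assume s: "\<sigma> \<in> ?G"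
    let ?h = "\<lambda>\<rho>. inv\<^bsub>G\<^esub> \<rho> \<otimes>\<^bsub>G\<^esub> \<sigma>"
    have hh: "?h (?h \<rho>) = \<rho>" if "\<rho> \<in> ?G" for \<rho>
      using that s by (simp add: G.inv_mult G.m_assoc)
    have inj: "inj_on ?h ?G" by (rule inj_on_inverseI[of _ ?h]) (rule hh)
    have im: "?h ` ?G = ?G"
    proof (intro equalityI subsetI)
      fix \<rho> assume "\<rho> \<in> ?G"
      then show "\<rho> \<in> ?h ` ?G" using s by (intro image_eqI[of _ ?h "?h \<rho>"]) (simp_all only: hh, auto)
    qed (use s in auto)
    have "(f \<otimes>\<^bsub>?A\<^esub> g) \<sigma> = (\<Oplus>\<^bsub>R\<^esub>\<rho>\<in>?h ` ?G. f \<rho> \<otimes>\<^bsub>R\<^esub> g (?h \<rho>))"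
      using s im by (simp add: mult)
    also have "\<dots> = (\<Oplus>\<^bsub>R\<^esub>\<rho>\<in>?G. f (?h \<rho>) \<otimes>\<^bsub>R\<^esub> g (?h (?h \<rho>)))"
      using s app[of f] app[of g] fg
      by (intro R.finsum_reindex inj) auto
    also have "\<dots> = (\<Oplus>\<^bsub>R\<^esub>\<rho>\<in>?G. g \<rho> \<otimes>\<^bsub>R\<^esub> f (?h \<rho>))"
      by (rule R.finsum_cong') (use s fg hh app in \<open>auto simp: R.m_comm\<close>)
    finally show "(f \<otimes>\<^bsub>?A\<^esub> g) \<sigma> = (g \<otimes>\<^bsub>?A\<^esub> f) \<sigma>" using s by (simp add: mult)
  qed (use fg mc in auto)
  have assoc: "(f \<otimes>\<^bsub>?A\<^esub> g) \<otimes>\<^bsub>?A\<^esub> k = f \<otimes>\<^bsub>?A\<^esub> (g \<otimes>\<^bsub>?A\<^esub> k)"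
    if fgk: "f \<in> carrier ?A" "g \<in> carrier ?A" "k \<in> carrier ?A" for f g k
  proof (rule ext)
    fix \<sigma> assume s: "\<sigma> \<in> ?G"
    have a: "f \<rho> \<in> carrier R" "g \<rho> \<in> carrier R" "k \<rho> \<in> carrier R" if "\<rho> \<in> ?G" for \<rho>
      using fgk app that by auto
    have "((f \<otimes>\<^bsub>?A\<^esub> g) \<otimes>\<^bsub>?A\<^esub> k) \<sigma> =
      (\<Oplus>\<^bsub>R\<^esub>\<rho>\<in>?G. (\<Oplus>\<^bsub>R\<^esub>\<pi>\<in>?G. f \<pi> \<otimes>\<^bsub>R\<^esub> g (inv\<^bsub>G\<^esub> \<pi> \<otimes>\<^bsub>G\<^esub> \<rho>)) \<otimes>\<^bsub>R\<^esub> k (inv\<^bsub>G\<^esub> \<rho> \<otimes>\<^bsub>G\<^esub> \<sigma>))"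
      unfolding mult[OF s]
      by (rule R.finsum_cong') (use s a in \<open>auto simp: mult intro!: R.m_closed R.finsum_closed\<close>)
    also have "\<dots> = (\<Oplus>\<^bsub>R\<^esub>\<rho>\<in>?G. \<Oplus>\<^bsub>R\<^esub>\<pi>\<in>?G. f \<pi> \<otimes>\<^bsub>R\<^esub> g (inv\<^bsub>G\<^esub> \<pi> \<otimes>\<^bsub>G\<^esub> \<rho>) \<otimes>\<^bsub>R\<^esub> k (inv\<^bsub>G\<^esub> \<rho> \<otimes>\<^bsub>G\<^esub> \<sigma>))"
      by (rule R.finsum_cong') (use s a fin in \<open>auto intro!: R.finsum_ldistr R.finsum_closed\<close>)
    also have "\<dots> = (\<Oplus>\<^bsub>R\<^esub>\<pi>\<in>?G. \<Oplus>\<^bsub>R\<^esub>\<rho>\<in>?G. f \<pi> \<otimes>\<^bsub>R\<^esub> g (inv\<^bsub>G\<^esub> \<pi> \<otimes>\<^bsub>G\<^esub> \<rho>) \<otimes>\<^bsub>R\<^esub> k (inv\<^bsub>G\<^esub> \<rho> \<otimes>\<^bsub>G\<^esub> \<sigma>))"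
      by (rule R.finsum_swap) (use s a fin in auto)
    also have "\<dots> = (\<Oplus>\<^bsub>R\<^esub>\<pi>\<in>?G. f \<pi> \<otimes>\<^bsub>R\<^esub> (g \<otimes>\<^bsub>?A\<^esub> k) (inv\<^bsub>G\<^esub> \<pi> \<otimes>\<^bsub>G\<^esub> \<sigma>))"
    proof (rule R.finsum_cong')
      fix \<pi> assume p: "\<pi> \<in> ?G"
      let ?t = "\<lambda>\<mu>. \<pi> \<otimes>\<^bsub>G\<^esub> \<mu>"
      have inj: "inj_on ?t ?G" using p by (simp add: G.inj_on_cmult)
      have im: "?t ` ?G = ?G" using p by (simp add: G.surj_const_mult)
      have simpl: "inv\<^bsub>G\<^esub> \<pi> \<otimes>\<^bsub>G\<^esub> (\<pi> \<otimes>\<^bsub>G\<^esub> \<mu>) = \<mu>"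
        "inv\<^bsub>G\<^esub> (\<pi> \<otimes>\<^bsub>G\<^esub> \<mu>) \<otimes>\<^bsub>G\<^esub> \<sigma> = inv\<^bsub>G\<^esub> \<mu> \<otimes>\<^bsub>G\<^esub> (inv\<^bsub>G\<^esub> \<pi> \<otimes>\<^bsub>G\<^esub> \<sigma>)" if "\<mu> \<in> ?G" for \<mu>
        using p s that by (simp_all add: G.m_assoc[symmetric] G.inv_mult_group)
      have "(\<Oplus>\<^bsub>R\<^esub>\<rho>\<in>?G. f \<pi> \<otimes>\<^bsub>R\<^esub> g (inv\<^bsub>G\<^esub> \<pi> \<otimes>\<^bsub>G\<^esub> \<rho>) \<otimes>\<^bsub>R\<^esub> k (inv\<^bsub>G\<^esub> \<rho> \<otimes>\<^bsub>G\<^esub> \<sigma>))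
        = (\<Oplus>\<^bsub>R\<^esub>\<rho>\<in>?t ` ?G. f \<pi> \<otimes>\<^bsub>R\<^esub> g (inv\<^bsub>G\<^esub> \<pi> \<otimes>\<^bsub>G\<^esub> \<rho>) \<otimes>\<^bsub>R\<^esub> k (inv\<^bsub>G\<^esub> \<rho> \<otimes>\<^bsub>G\<^esub> \<sigma>))"
        using im by simp
      also have "\<dots> = (\<Oplus>\<^bsub>R\<^esub>\<mu>\<in>?G. f \<pi> \<otimes>\<^bsub>R\<^esub> g (inv\<^bsub>G\<^esub> \<pi> \<otimes>\<^bsub>G\<^esub> ?t \<mu>) \<otimes>\<^bsub>R\<^esub> k (inv\<^bsub>G\<^esub> ?t \<mu> \<otimes>\<^bsub>G\<^esub> \<sigma>))"
        by (rule R.finsum_reindex[OF _ inj]) (use p s a in auto)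
      also have "\<dots> = (\<Oplus>\<^bsub>R\<^esub>\<mu>\<in>?G. f \<pi> \<otimes>\<^bsub>R\<^esub> (g \<mu> \<otimes>\<^bsub>R\<^esub> k (inv\<^bsub>G\<^esub> \<mu> \<otimes>\<^bsub>G\<^esub> (inv\<^bsub>G\<^esub> \<pi> \<otimes>\<^bsub>G\<^esub> \<sigma>))))"
        by (rule R.finsum_cong') (use p s a simpl in \<open>auto simp: R.m_assoc\<close>)
      also have "\<dots> = f \<pi> \<otimes>\<^bsub>R\<^esub> (\<Oplus>\<^bsub>R\<^esub>\<mu>\<in>?G. g \<mu> \<otimes>\<^bsub>R\<^esub> k (inv\<^bsub>G\<^esub> \<mu> \<otimes>\<^bsub>G\<^esub> (inv\<^bsub>G\<^esub> \<pi> \<otimes>\<^bsub>G\<^esub> \<sigma>)))"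
        by (rule R.finsum_rdistr[symmetric]) (use p s a fin in auto)
      also have "\<dots> = f \<pi> \<otimes>\<^bsub>R\<^esub> (g \<otimes>\<^bsub>?A\<^esub> k) (inv\<^bsub>G\<^esub> \<pi> \<otimes>\<^bsub>G\<^esub> \<sigma>)"
        using p s by (simp add: mult)
      finally show "(\<Oplus>\<^bsub>R\<^esub>\<rho>\<in>?G. f \<pi> \<otimes>\<^bsub>R\<^esub> g (inv\<^bsub>G\<^esub> \<pi> \<otimes>\<^bsub>G\<^esub> \<rho>) \<otimes>\<^bsub>R\<^esub> k (inv\<^bsub>G\<^esub> \<rho> \<otimes>\<^bsub>G\<^esub> \<sigma>))
        = f \<pi> \<otimes>\<^bsub>R\<^esub> (g \<otimes>\<^bsub>?A\<^esub> k) (inv\<^bsub>G\<^esub> \<pi> \<otimes>\<^bsub>G\<^esub> \<sigma>)" .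
    qed (use s a app[OF mc[OF fgk(2,3)]] in auto)
    also have "\<dots> = (f \<otimes>\<^bsub>?A\<^esub> (g \<otimes>\<^bsub>?A\<^esub> k)) \<sigma>"
      by (rule mult[OF s, symmetric])
    finally show "((f \<otimes>\<^bsub>?A\<^esub> g) \<otimes>\<^bsub>?A\<^esub> k) \<sigma> = (f \<otimes>\<^bsub>?A\<^esub> (g \<otimes>\<^bsub>?A\<^esub> k)) \<sigma>" .
  qed (use fgk mc in auto)
  have one_l: "\<one>\<^bsub>?A\<^esub> \<otimes>\<^bsub>?A\<^esub> f = f" if f: "f \<in> carrier ?A" for f
  proof (rule ext)
    fix \<sigma> assume s: "\<sigma> \<in> ?G"
    have "(\<one>\<^bsub>?A\<^esub> \<otimes>\<^bsub>?A\<^esub> f) \<sigma> = (\<Oplus>\<^bsub>R\<^esub>\<rho>\<in>?G. if \<one>\<^bsub>G\<^esub> = \<rho> then f (inv\<^bsub>G\<^esub> \<rho> \<otimes>\<^bsub>G\<^esub> \<sigma>) else \<zero>\<^bsub>R\<^esub>)"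
      unfolding mult[OF s] by (rule R.finsum_cong') (use s app[OF f] in \<open>auto simp: one\<close>)
    also have "\<dots> = f \<sigma>"
      using R.finsum_singleton[of "\<one>\<^bsub>G\<^esub>" ?G "\<lambda>\<rho>. f (inv\<^bsub>G\<^esub> \<rho> \<otimes>\<^bsub>G\<^esub> \<sigma>)"] s app[OF f] fin by auto
    finally show "(\<one>\<^bsub>?A\<^esub> \<otimes>\<^bsub>?A\<^esub> f) \<sigma> = f \<sigma>" .
  qed (use f mc oc in auto)
  have distr: "(f \<oplus>\<^bsub>?A\<^esub> g) \<otimes>\<^bsub>?A\<^esub> k = f \<otimes>\<^bsub>?A\<^esub> k \<oplus>\<^bsub>?A\<^esub> g \<otimes>\<^bsub>?A\<^esub> k"
    if fgk: "f \<in> carrier ?A" "g \<in> carrier ?A" "k \<in> carrier ?A" for f g k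
  proof (rule ext)
    fix \<sigma> assume s: "\<sigma> \<in> ?G"
    have a: "f \<rho> \<in> carrier R" "g \<rho> \<in> carrier R" "k \<rho> \<in> carrier R" if "\<rho> \<in> ?G" for \<rho>
      using fgk app that by auto
    have "((f \<oplus>\<^bsub>?A\<^esub> g) \<otimes>\<^bsub>?A\<^esub> k) \<sigma> = (\<Oplus>\<^bsub>R\<^esub>\<rho>\<in>?G. f \<rho> \<otimes>\<^bsub>R\<^esub> k (inv\<^bsub>G\<^esub> \<rho> \<otimes>\<^bsub>G\<^esub> \<sigma>) \<oplus>\<^bsub>R\<^esub> g \<rho> \<otimes>\<^bsub>R\<^esub> k (inv\<^bsub>G\<^esub> \<rho> \<otimes>\<^bsub>G\<^esub> \<sigma>))"
      unfolding mult[OF s] by (rule R.finsum_cong') (use s a in \<open>auto simp: add R.l_distr\<close>)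
    also have "\<dots> = (f \<otimes>\<^bsub>?A\<^esub> k \<oplus>\<^bsub>?A\<^esub> g \<otimes>\<^bsub>?A\<^esub> k) \<sigma>"
      unfolding add[OF s] mult[OF s] by (rule R.finsum_addf) (use s a in auto)
    finally show "((f \<oplus>\<^bsub>?A\<^esub> g) \<otimes>\<^bsub>?A\<^esub> k) \<sigma> = (f \<otimes>\<^bsub>?A\<^esub> k \<oplus>\<^bsub>?A\<^esub> g \<otimes>\<^bsub>?A\<^esub> k) \<sigma>" .
  qed (use fgk mc ac in auto)
  have "abelian_group ?A"
  proof (rule abelian_groupI)
    fix f assume f: "f \<in> carrier ?A"
    let ?m = "\<lambda>\<sigma>\<in>?G. \<ominus>\<^bsub>R\<^esub> f \<sigma>"
    have m: "?m \<in> carrier ?A" using app[OF f] by (auto simp: defs)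
    have "?m \<oplus>\<^bsub>?A\<^esub> f = \<zero>\<^bsub>?A\<^esub>"
      by (rule ext) (use f m ac zc app[OF f] in \<open>auto simp: add zero R.l_neg\<close>)
    with m show "\<exists>g\<in>carrier ?A. g \<oplus>\<^bsub>?A\<^esub> f = \<zero>\<^bsub>?A\<^esub>" by blast
  next
    fix f g k assume *: "f \<in> carrier ?A" "g \<in> carrier ?A" "k \<in> carrier ?A"
    show "f \<oplus>\<^bsub>?A\<^esub> g \<oplus>\<^bsub>?A\<^esub> k = f \<oplus>\<^bsub>?A\<^esub> (g \<oplus>\<^bsub>?A\<^esub> k)"
      by (rule ext) (use * ac app in \<open>auto simp: add R.a_assoc\<close>)
  next
    fix f g assume *: "f \<in> carrier ?A" "g \<in> carrier ?A"
    show "f \<oplus>\<^bsub>?A\<^esub> g = g \<oplus>\<^bsub>?A\<^esub> f"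
      by (rule ext) (use * ac app in \<open>auto simp: add R.a_comm\<close>)
  next
    fix f assume *: "f \<in> carrier ?A"
    show "\<zero>\<^bsub>?A\<^esub> \<oplus>\<^bsub>?A\<^esub> f = f"
      by (rule ext) (use * ac zc app in \<open>auto simp: add zero\<close>)
  qed (use ac zc in auto)
  moreover have "Group.comm_monoid ?A"
    by (rule comm_monoidI) (use mc oc assoc one_l comm in auto)
  ultimately show ?thesis by (rule cringI) (rule distr)
qed

text \<open>The element \<open>a \<cdot> \<sigma>\<close> of \<open>R[G]\<close>. In particular \<open>\<sigma>\<close> itself is \<open>\<one> \<cdot> \<sigma>\<close>, and the scalar \<open>a\<close> is
  \<open>a \<cdot> \<one>\<close>.\<close>

definition monomial ::
  "('r, 'c) ring_scheme \<Rightarrow> ('g, 'd) monoid_scheme \<Rightarrow> 'r \<Rightarrow> 'g \<Rightarrow> ('g \<Rightarrow> 'r)" where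
  "monomial R G a \<sigma> = (\<lambda>\<rho>\<in>carrier G. if \<rho> = \<sigma> then a else \<zero>\<^bsub>R\<^esub>)"

abbreviation group_elt ::
  "('r, 'c) ring_scheme \<Rightarrow> ('g, 'd) monoid_scheme \<Rightarrow> 'g \<Rightarrow> ('g \<Rightarrow> 'r)" where
  "group_elt R G \<sigma> \<equiv> monomial R G \<one>\<^bsub>R\<^esub> \<sigma>"

abbreviation scalar_elt ::
  "('r, 'c) ring_scheme \<Rightarrow> ('g, 'd) monoid_scheme \<Rightarrow> 'r \<Rightarrow> ('g \<Rightarrow> 'r)" where
  "scalar_elt R G a \<equiv> monomial R G a \<one>\<^bsub>G\<^esub>"

definition char_power ::
  "('r, 'c) ring_scheme \<Rightarrow> ('g \<Rightarrow> 'r) \<Rightarrow> nat \<Rightarrow> 'g \<Rightarrow> 'r" where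
  "char_power R \<chi> i = (\<lambda>\<sigma>. \<chi> \<sigma> [^]\<^bsub>R\<^esub> i)"

definition eps ::
  "('r, 'c) ring_scheme \<Rightarrow> ('g, 'd) monoid_scheme \<Rightarrow> ('g \<Rightarrow> 'r) \<Rightarrow> ('g \<Rightarrow> 'r)" where
  "eps R G \<psi> = (\<Oplus>\<^bsub>group_ring R G\<^esub>\<sigma>\<in>carrier G. monomial R G (inv\<^bsub>R\<^esub> (\<psi> \<sigma>)) \<sigma>)"

text \<open>The subset \<open>a M\<close> of \<open>M\<close>.\<close>

definition smult_image :: "('a, 'm, 'z) module_scheme \<Rightarrow> 'a \<Rightarrow> 'm set" where
  "smult_image M a = (\<lambda>m. a \<odot>\<^bsub>M\<^esub> m) ` carrier M"

definition char_part ::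
  "('r, 'c) ring_scheme \<Rightarrow> ('g, 'd) monoid_scheme \<Rightarrow> ('g \<Rightarrow> 'r, 'm, 'z) module_scheme
    \<Rightarrow> ('g \<Rightarrow> 'r) \<Rightarrow> 'm set" where
  "char_part R G M \<psi> =
     {m \<in> carrier M. \<forall>\<sigma>\<in>carrier G.
        group_elt R G \<sigma> \<odot>\<^bsub>M\<^esub> m = scalar_elt R G (\<psi> \<sigma>) \<odot>\<^bsub>M\<^esub> m}"

text \<open>
  Quotients are formed as quotients of the underlying additive groups. Since the cosets of
  \<open>\<epsilon>\<^sub>\<psi> M\<close> in a subgroup of \<open>M\<close> are literally cosets in \<open>M\<close>, the carrier of \<open>tate_S\<close> is literally a
  subset of the carrier of \<open>tate_H0\<close>, so that \<open>tate_H0 \<dots> Mod carrier (tate_S \<dots>)\<close> makes sense.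
\<close>

definition tate_H0 ::
  "('r, 'c) ring_scheme \<Rightarrow> ('g, 'd) monoid_scheme \<Rightarrow> ('g \<Rightarrow> 'r, 'm, 'z) module_scheme
    \<Rightarrow> ('g \<Rightarrow> 'r) \<Rightarrow> 'm set monoid" where
  "tate_H0 R G M \<psi> =
     (M\<lparr>carrier := char_part R G M \<psi>\<rparr>) A_Mod (smult_image M (eps R G \<psi>))"

text \<open>The product over \<open>i < j < order G\<close> of \<open>\<tau> - z^j \<in> R[G]\<close>; it is \<open>1\<close> if there is no such \<open>j\<close>.\<close>

definition tail_prod ::
  "('r, 'c) ring_scheme \<Rightarrow> ('g, 'd) monoid_scheme \<Rightarrow> 'g \<Rightarrow> 'r \<Rightarrow> nat \<Rightarrow> ('g \<Rightarrow> 'r)" where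
  "tail_prod R G \<tau> z i =
     (\<Otimes>\<^bsub>group_ring R G\<^esub>j\<in>{i+1..<Coset.order G}.
        group_elt R G \<tau> \<ominus>\<^bsub>group_ring R G\<^esub> scalar_elt R G (z [^]\<^bsub>R\<^esub> j))"

definition tate_S ::
  "('r, 'c) ring_scheme \<Rightarrow> ('g, 'd) monoid_scheme \<Rightarrow> ('g \<Rightarrow> 'r, 'm, 'z) module_scheme
    \<Rightarrow> 'g \<Rightarrow> 'r \<Rightarrow> ('g \<Rightarrow> 'r) \<Rightarrow> nat \<Rightarrow> 'm set monoid" where
  "tate_S R G M \<tau> z \<chi> i =
     (M\<lparr>carrier := char_part R G M (char_power R \<chi> i) \<inter> smult_image M (tail_prod R G \<tau> z i)\<rparr>)
       A_Mod (smult_image M (eps R G (char_power R \<chi> i)))"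

end

theory Submission
  imports Defs
begin

text \<open>
  Write \<open>P\<^sub>i\<close> for the product of the \<open>\<tau> - \<zeta>\<^sup>j\<close> with \<open>i < j < n\<close>. Multiplication by \<open>\<tau> - \<zeta>\<^sup>i\<close> maps
  \<open>P\<^sub>i M\<close> onto \<open>P\<^bsub>i-1\<^esub> M\<close>, and its kernel is the intersection of \<open>P\<^sub>i M\<close> with the \<open>\<chi>\<^sup>i\<close>-part of \<open>M\<close>. The chain starts at \<open>M\<close> and ends at \<open>0\<close>, because
  the product of all \<open>\<tau> - \<zeta>\<^sup>j\<close> is \<open>\<tau>\<^sup>n - 1 = 0\<close>; so \<open>[M]\<close> is the product of the orders of these
  kernels. Moreover \<open>\<epsilon>\<close> for \<open>\<chi>\<^sup>i\<close> is \<open>\<zeta>\<^sup>i\<close> times the product of the \<open>\<tau> - \<zeta>\<^sup>j\<close> with \<open>j \<noteq> i\<close>, so it lies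
  in the ideal generated by \<open>P\<^sub>i\<close> and is annihilated by \<open>\<tau> - \<zeta>\<^sup>i\<close>. Both identities hold in \<open>R[G]\<close>
  because they hold in \<open>\<int>[\<zeta>][X]\<close>, where they can be checked over the complex numbers; \<open>R\<close> itself need
  not be a domain.
\<close>

section \<open>Orders of quotients and of images in abelian groups\<close>

lemma (in comm_group) comm_group_subgroup:
  assumes "subgroup H G"
  shows "comm_group (G\<lparr>carrier := H\<rparr>)"
  by (rule group.group_comm_groupI)
     (use assms subgroup.subgroup_is_group[OF _ is_group] subgroup.subset in \<open>auto intro!: m_comm\<close>)

lemma (in comm_group) order_subgroup_Mod:
  assumes "subgroup I G" "subgroup H G" "I \<subseteq> H"
  shows "Coset.order (G\<lparr>carrier := H\<rparr> Mod I) * card I = card H"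
proof -
  interpret H: comm_group "G\<lparr>carrier := H\<rparr>" using comm_group_subgroup assms by blast
  show ?thesis
    using H.lagrange[OF subgroup_incl[OF assms]] by (simp add: Coset.order_def FactGroup_def)
qed

text \<open>This is Lagrange's theorem in \<open>H/I\<close> for its subgroup \<open>K/I\<close>.
  The cosets of \<open>I\<close> in \<open>K\<close> are literally cosets of \<open>I\<close> in
  \<open>H\<close>, so no isomorphism has to be chosen.\<close>

lemma (in comm_group) order_subgroup_Mod_Mod:
  assumes "subgroup I G" "subgroup K G" "subgroup H G" "I \<subseteq> K" "K \<subseteq> H"
  shows "Coset.order ((G\<lparr>carrier := H\<rparr> Mod I) Mod carrier (G\<lparr>carrier := K\<rparr> Mod I))
      * Coset.order (G\<lparr>carrier := K\<rparr> Mod I) = Coset.order (G\<lparr>carrier := H\<rparr> Mod I)"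
proof -
  have IH: "I \<subseteq> H" using assms by simp
  interpret H: comm_group "G\<lparr>carrier := H\<rparr>"
    using comm_group_subgroup assms by blast
  interpret K: comm_group "G\<lparr>carrier := K\<rparr>"
    using comm_group_subgroup assms by blast
  interpret HI: comm_group "G\<lparr>carrier := H\<rparr> Mod I"
    by (rule H.abelian_FactGroup) (rule subgroup_incl[OF assms(1,3) IH])
  interpret KI: comm_group "G\<lparr>carrier := K\<rparr> Mod I"
    by (rule K.abelian_FactGroup) (rule subgroup_incl[OF assms(1,2,4)])
  \<comment> \<open>The product of cosets does not refer to the carrier, so restricting
    \<open>H/I\<close> to the cosets inside \<open>K\<close> gives \<open>K/I\<close> as an equal
    record.\<close>
  have eq: "(G\<lparr>carrier := H\<rparr> Mod I)\<lparr>carrier := carrier (G\<lparr>carrier := K\<rparr> Mod I)\<rparr> = G\<lparr>carrier := K\<rparr> Mod I"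
    by (simp add: FactGroup_def set_mult_def fun_eq_iff)
  have "subgroup (carrier (G\<lparr>carrier := K\<rparr> Mod I)) (G\<lparr>carrier := H\<rparr> Mod I)"
  proof (rule HI.group_incl_imp_subgroup)
    show "carrier (G\<lparr>carrier := K\<rparr> Mod I) \<subseteq> carrier (G\<lparr>carrier := H\<rparr> Mod I)"
      using assms(5) by (auto simp: carrier_FactGroup r_coset_def)
    show "group ((G\<lparr>carrier := H\<rparr> Mod I)\<lparr>carrier := carrier (G\<lparr>carrier := K\<rparr> Mod I)\<rparr>)"
      unfolding eq by (rule KI.is_group)
  qed
  from HI.lagrange[OF this] show ?thesis by (simp add: Coset.order_def FactGroup_def)
qed

text \<open>The first isomorphism theorem for the restriction of \<open>h\<close> to
  \<open>N\<close>, combined with Lagrange's theorem for its kernel.\<close>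

lemma (in comm_group) card_hom_image:
  assumes "subgroup N G" "h \<in> hom G G"
  shows "card N = card (h ` N) * card ({x \<in> N. h x = \<one>})"
proof -
  interpret N: comm_group "G\<lparr>carrier := N\<rparr>" using comm_group_subgroup assms by blast
  have "group_hom (G\<lparr>carrier := N\<rparr>) G h"
    using assms subgroup.subset[OF assms(1)]
    by unfold_locales (auto simp: hom_def Pi_iff)
  then interpret I: comm_group "G\<lparr>carrier := h ` N\<rparr>"
    using comm_group_subgroup group_hom.img_is_subgroup by fastforce
  interpret f: group_hom "G\<lparr>carrier := N\<rparr>" "G\<lparr>carrier := h ` N\<rparr>" h
    using assms subgroup.subset[OF assms(1)]
    by unfold_locales (auto simp: hom_def Pi_iff)
  let ?K = "kernel (G\<lparr>carrier := N\<rparr>) (G\<lparr>carrier := h ` N\<rparr>) h"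
  have "card (rcosets\<^bsub>G\<lparr>carrier := N\<rparr>\<^esub> ?K) = card (h ` N)"
    using f.FactGroup_iso_set by (auto simp: iso_def FactGroup_def dest: bij_betw_same_card)
  moreover have "?K = {x \<in> N. h x = \<one>}" by (simp add: kernel_def)
  ultimately show ?thesis
    using N.lagrange[OF f.subgroup_kernel] by (simp add: Coset.order_def)
qed

section \<open>Products of linear factors, over the complex numbers and in a commutative
  ring\<close>

text \<open>Both sides have degree at most \<open>n\<close> and the same coefficient at
  \<open>n\<close>, and both vanish at the \<open>n\<close> powers of \<open>z\<close>, which are
  distinct because \<open>z\<close> is primitive.\<close>

lemma prod_roots_of_1:
  assumes "primitive_root_of_1 n z"
  shows "(\<Prod>j<n. [:-(z^j), 1:]) = (monom 1 n - 1 :: complex poly)"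
proof -
  have n: "0 < n" and zn: "z ^ n = 1" and prim: "\<And>k. 0 < k \<Longrightarrow> k < n \<Longrightarrow> z ^ k \<noteq> 1"
    using assms by (auto simp: primitive_root_of_1_def)
  have z0: "z \<noteq> 0" using n zn by (auto simp: power_0_left)
  have neq: "z ^ i \<noteq> z ^ j" if "i < j" "j < n" for i j
  proof
    assume "z ^ i = z ^ j"
    moreover have "z ^ j = z ^ i * z ^ (j - i)" using that by (simp flip: power_add)
    ultimately have "z ^ (j - i) = 1" using z0 by simp
    with prim[of "j - i"] that show False by linarith
  qed
  have inj: "inj_on (\<lambda>j. z ^ j) {..<n}"
  proof (rule inj_onI)
    fix i j assume "i \<in> {..<n}" "j \<in> {..<n}" "z ^ i = z ^ j"
    then show "i = j" using neq[of i j] neq[of j i] by (cases i j rule: linorder_cases) auto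
  qed
  have deg: "degree (\<Prod>j<n. [:-(z^j), 1:]) = n"
    by (subst degree_prod_eq_sum_degree) auto
  have lc: "lead_coeff (\<Prod>j<n. [:-(z^j), 1:]) = 1"
    by (simp add: lead_coeff_prod)
  show ?thesis
  proof (rule poly_eqI_degree_lead_coeff[where n = n and A = "(\<lambda>j. z ^ j) ` {..<n}"])
    show "Polynomial.coeff (\<Prod>j<n. [:-(z^j), 1:]) n = Polynomial.coeff (monom 1 n - 1) n"
      using lc deg n by simp
    show "card ((\<lambda>j. z ^ j) ` {..<n}) \<ge> n" using inj by (simp add: card_image)
    show "degree (monom 1 n - 1 :: complex poly) \<le> n"
      by (intro degree_diff_le) (auto simp: degree_monom_le)
    show "poly (\<Prod>j<n. [:-(z^j), 1:]) x = poly (monom 1 n - 1) x"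
      if "x \<in> (\<lambda>j. z ^ j) ` {..<n}" for x
    proof -
      from that obtain j where j: "j < n" "x = z ^ j" by auto
      have "x ^ n = 1" using j zn by (metis power_mult mult.commute power_one)
      moreover have "(\<Prod>i<n. x - z ^ i) = 0" using j by (auto intro!: bexI[of _ j])
      ultimately show ?thesis by (simp add: poly_prod poly_monom)
    qed
  qed (use deg in auto)
qed

text \<open>The polynomial is \<open>X^n - 1\<close> divided by \<open>X - z^i\<close>. The division
  is a cancellation, valid because complex polynomials form a domain; this is why it is done before
  passing to \<open>R\<close>.\<close>

lemma prod_roots_of_1_remove:
  assumes "primitive_root_of_1 n z" "i < n"
  shows "(\<Prod>j\<in>{..<n}-{i}. [:-(z^j), 1:]) = (\<Sum>k<n. monom (z ^ (i * (n - Suc k))) k)"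
proof -
  have "[:-(z^i), 1:] * (\<Prod>j\<in>{..<n}-{i}. [:-(z^j), 1:]) = (\<Prod>j<n. [:-(z^j), 1:])"
    using assms(2) by (subst (2) prod.remove[of _ i]) auto
  \<comment> \<open>The constant \<open>1\<close> is written as \<open>(z^i)^n\<close>, so that the
    factorization of a difference of \<open>n\<close>-th powers applies.\<close>
  also have "\<dots> = [:0, 1:] ^ n - [:z ^ i:] ^ n"
    using assms by (simp add: prod_roots_of_1 monom_altdef primitive_root_of_1_def
        poly_const_pow flip: power_mult) (simp add: mult.commute[of i] power_mult one_pCons)
  also have "\<dots> = ([:0, 1:] - [:z ^ i:]) * (\<Sum>k<n. [:z ^ i:] ^ (n - Suc k) * [:0, 1:] ^ k)"
    by (rule power_diff_sumr2)
  also have "(\<Sum>k<n. [:z ^ i:] ^ (n - Suc k) * [:0, 1:] ^ k) = (\<Sum>k<n. monom (z ^ (i * (n - Suc k))) k)"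
    by (intro sum.cong refl) (simp add: poly_const_pow monom_altdef power_mult)
  also have "[:0, 1:] - [:z ^ i:] = [:-(z^i), 1:]" by simp
  finally show ?thesis by (subst (asm) mult_cancel_left) auto
qed


text \<open>The bridge from polynomials over a type to the ring \<open>R\<close>: here
  \<open>S\<close> is a subring, \<open>\<phi>\<close> is a homomorphism on \<open>S\<close>, and
  the product polynomial is evaluated at \<open>t\<close> after \<open>\<phi>\<close> is applied to
  its coefficients. An identity of polynomials thereby becomes an identity in
  \<open>R\<close>.\<close>

lemma (in cring) finprod_linear_factors:
  fixes c :: "'i \<Rightarrow> 'e::comm_ring_1" and \<phi> :: "'e \<Rightarrow> 'a"
  assumes S: "1 \<in> S" "\<And>x y. x \<in> S \<Longrightarrow> y \<in> S \<Longrightarrow> x - y \<in> S \<and> x * y \<in> S"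
    and \<phi>: "\<phi> \<in> S \<rightarrow> carrier R" "\<phi> 1 = \<one>"
      "\<And>x y. x \<in> S \<Longrightarrow> y \<in> S \<Longrightarrow> \<phi> (x - y) = \<phi> x \<ominus> \<phi> y \<and> \<phi> (x * y) = \<phi> x \<otimes> \<phi> y"
    and J: "finite J" "c ` J \<subseteq> S" and t: "t \<in> carrier R"
  shows "(\<Otimes>j\<in>J. t \<ominus> \<phi> (c j)) =
    (\<Oplus>k\<in>{..card J}. \<phi> (Polynomial.coeff (\<Prod>j\<in>J. [:- c j, 1:]) k) \<otimes> t [^] k)"
proof -
  have S0: "0 \<in> S" using S(2)[OF S(1) S(1)] by simp
  have \<phi>0: "\<phi> 0 = \<zero>" using \<phi>(3)[OF S(1) S(1)] \<phi>(2) by (simp add: a_minus_def r_neg)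
  have \<phi>c [simp]: "\<phi> x \<in> carrier R" if "x \<in> S" for x using \<phi>(1) that by auto
  have deg: "degree (\<Prod>j\<in>J. [:- c j, 1:]) \<le> card J" for J
    using degree_prod_sum_le[of J "\<lambda>j. [:- c j, 1:]"]
    by (cases "finite J") auto
  \<comment> \<open>That the coefficients stay in \<open>S\<close> is carried through the induction,
    because \<open>\<phi>\<close> respects the operations only there.\<close>
  have "(\<forall>k. Polynomial.coeff (\<Prod>j\<in>J. [:- c j, 1:]) k \<in> S) \<and> (\<Otimes>j\<in>J. t \<ominus> \<phi> (c j)) =
    (\<Oplus>k\<in>{..card J}. \<phi> (Polynomial.coeff (\<Prod>j\<in>J. [:- c j, 1:]) k) \<otimes> t [^] k)"
    using J
  proof (induction J rule: finite_induct)
    case empty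
    then show ?case using S(1) S0 t \<phi>(2) by (simp add: one_pCons coeff_pCons split: nat.split)
  next
    case (insert x J)
    let ?p = "\<Prod>j\<in>J. [:- c j, 1:]"
    let ?a = "\<lambda>k. Polynomial.coeff ?p k"
    let ?b = "\<lambda>k. Polynomial.coeff (\<Prod>j\<in>insert x J. [:- c j, 1:]) k"
    let ?d = "card J"
    have IH: "?a k \<in> S" "(\<Otimes>j\<in>J. t \<ominus> \<phi> (c j)) = (\<Oplus>k\<in>{..?d}. \<phi> (?a k) \<otimes> t [^] k)" for k
      using insert by auto
    have cx: "c x \<in> S" using insert.prems by auto
    have cS: "c j \<in> S" if "j \<in> J" for j using insert.prems that by auto
    \<comment> \<open>Multiplication by \<open>X - c x\<close> shifts the coefficients up by one and
      subtracts \<open>c x\<close> times the old ones.\<close>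
    have b: "?b k = (case k of 0 \<Rightarrow> 0 | Suc l \<Rightarrow> ?a l) - c x * ?a k" for k
      using insert.hyps by (simp add: coeff_pCons split: nat.split)
    have bS: "?b k \<in> S" for k
      using S(2) cx IH(1) S0 unfolding b by (auto split: nat.split)
    have mS: "c x * ?a k \<in> S" for k using S(2) cx IH(1) by auto
    have ad: "?a (Suc ?d) = 0" using deg[of J] by (intro coeff_eq_0) simp
    have \<phi>b: "\<phi> (?b k) = (case k of 0 \<Rightarrow> \<zero> | Suc l \<Rightarrow> \<phi> (?a l)) \<ominus> \<phi> (c x) \<otimes> \<phi> (?a k)" for k
      unfolding b using \<phi>(3) cx IH(1) S0 mS \<phi>0 by (auto split: nat.split)
    have "(\<Otimes>j\<in>insert x J. t \<ominus> \<phi> (c j)) = (t \<ominus> \<phi> (c x)) \<otimes> (\<Oplus>k\<in>{..?d}. \<phi> (?a k) \<otimes> t [^] k)"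
      using insert.hyps cx cS t by (subst finprod_insert) (auto simp: IH(2))
    also have "\<dots> = t \<otimes> (\<Oplus>k\<in>{..?d}. \<phi> (?a k) \<otimes> t [^] k) \<oplus> (\<ominus> \<phi> (c x)) \<otimes> (\<Oplus>k\<in>{..?d}. \<phi> (?a k) \<otimes> t [^] k)"
    proof -
      have "(\<Oplus>k\<in>{..?d}. \<phi> (?a k) \<otimes> t [^] k) \<in> carrier R"
        using IH(1) t by (intro finsum_closed) auto
      then show ?thesis using t cx by (simp add: minus_eq l_distr)
    qed
    also have "t \<otimes> (\<Oplus>k\<in>{..?d}. \<phi> (?a k) \<otimes> t [^] k) = (\<Oplus>k\<in>{..?d}. \<phi> (?a k) \<otimes> t [^] Suc k)"
      using IH(1) t by (subst finsum_rdistr) (auto intro!: finsum_cong' simp: m_ac nat_pow_Suc)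
    \<comment> \<open>Both sums are brought to the range \<open>{..Suc ?d}\<close>: the shifted one
      gains a zero term at \<open>0\<close>, and the other one below gains a zero term at
      \<open>Suc ?d\<close>, by \<open>ad\<close>.\<close>
    also have "\<dots> = (\<Oplus>k\<in>{..Suc ?d}. (case k of 0 \<Rightarrow> \<zero> | Suc l \<Rightarrow> \<phi> (?a l)) \<otimes> t [^] k)"
      using IH(1) t by (subst finsum_Suc2) (auto split: nat.split)
    also have "(\<ominus> \<phi> (c x)) \<otimes> (\<Oplus>k\<in>{..?d}. \<phi> (?a k) \<otimes> t [^] k) = (\<Oplus>k\<in>{..?d}. (\<ominus> \<phi> (c x)) \<otimes> \<phi> (?a k) \<otimes> t [^] k)"
      using IH(1) t cx by (subst finsum_rdistr) (auto intro!: finsum_cong' simp: m_ac)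
    also have "\<dots> = (\<Oplus>k\<in>{..Suc ?d}. (\<ominus> \<phi> (c x)) \<otimes> \<phi> (?a k) \<otimes> t [^] k)"
      using IH(1) t cx by (subst finsum_Suc) (auto simp: ad \<phi>0)
    also have "(\<Oplus>k\<in>{..Suc ?d}. (case k of 0 \<Rightarrow> \<zero> | Suc l \<Rightarrow> \<phi> (?a l)) \<otimes> t [^] k) \<oplus> \<dots> =
      (\<Oplus>k\<in>{..Suc ?d}. (case k of 0 \<Rightarrow> \<zero> | Suc l \<Rightarrow> \<phi> (?a l)) \<otimes> t [^] k \<oplus> (\<ominus> \<phi> (c x)) \<otimes> \<phi> (?a k) \<otimes> t [^] k)"
      using IH(1) t cx by (subst finsum_addf) (auto split: nat.split)
    also have "\<dots> = (\<Oplus>k\<in>{..Suc ?d}. \<phi> (?b k) \<otimes> t [^] k)"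
      using IH(1) t cx bS by (intro finsum_cong')
        (auto simp: \<phi>b minus_eq l_distr l_minus split: nat.split)
    finally show ?case using bS insert.hyps by simp
  qed
  then show ?thesis ..
qed

section \<open>Kernels and images of multiplication by a ring element on a module\<close>

lemma (in module) minus_smult_eq_zero_iff:
  assumes "a \<in> carrier R" "b \<in> carrier R" "m \<in> carrier M"
  shows "(a \<ominus> b) \<odot>\<^bsub>M\<^esub> m = \<zero>\<^bsub>M\<^esub> \<longleftrightarrow> a \<odot>\<^bsub>M\<^esub> m = b \<odot>\<^bsub>M\<^esub> m"
proof -
  have "(a \<ominus> b) \<odot>\<^bsub>M\<^esub> m = a \<odot>\<^bsub>M\<^esub> m \<oplus>\<^bsub>M\<^esub> \<ominus>\<^bsub>M\<^esub> (b \<odot>\<^bsub>M\<^esub> m)"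
    using assms by (simp add: R.minus_eq smult_l_distr smult_l_minus)
  then show ?thesis
    using assms M.minus_equality[of "a \<odot>\<^bsub>M\<^esub> m" "\<ominus>\<^bsub>M\<^esub> (b \<odot>\<^bsub>M\<^esub> m)"]
    by (auto simp: M.r_neg)
qed

text \<open>By commutativity \<open>b\<close> moves past \<open>a [^] k\<close>. This serves to pass
  from the generator \<tau> to all of its powers in the condition that defines a character
  part.\<close>

lemma (in module) nat_pow_smult_eq:
  assumes "a \<in> carrier R" "b \<in> carrier R" "m \<in> carrier M" "a \<odot>\<^bsub>M\<^esub> m = b \<odot>\<^bsub>M\<^esub> m"
  shows "a [^] (k::nat) \<odot>\<^bsub>M\<^esub> m = b [^] k \<odot>\<^bsub>M\<^esub> m"
proof (induction k)
  case (Suc k)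
  have "a [^] Suc k \<odot>\<^bsub>M\<^esub> m = a [^] k \<odot>\<^bsub>M\<^esub> (b \<odot>\<^bsub>M\<^esub> m)"
    using assms by (simp add: smult_assoc1)
  also have "\<dots> = b \<odot>\<^bsub>M\<^esub> (a [^] k \<odot>\<^bsub>M\<^esub> m)"
    using assms by (simp add: R.m_comm flip: smult_assoc1)
  also have "\<dots> = b [^] Suc k \<odot>\<^bsub>M\<^esub> m"
    using assms by (simp add: Suc R.m_comm flip: smult_assoc1)
  finally show ?case .
qed simp

lemma (in module) smult_hom:
  assumes "a \<in> carrier R"
  shows "(\<lambda>m. a \<odot>\<^bsub>M\<^esub> m) \<in> hom (add_monoid M) (add_monoid M)"
  using assms by (auto simp: hom_def smult_r_distr)

lemma (in module) group_hom_smult: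
  assumes "a \<in> carrier R"
  shows "group_hom (add_monoid M) (add_monoid M) (\<lambda>m. a \<odot>\<^bsub>M\<^esub> m)"
  using smult_hom[OF assms] M.a_group by (simp add: group_hom_def group_hom_axioms_def)

lemma (in module) subgroup_smult_image:
  assumes "a \<in> carrier R"
  shows "subgroup (smult_image M a) (add_monoid M)"
  using group_hom.img_is_subgroup[OF group_hom_smult[OF assms]] by (simp add: smult_image_def)

lemma (in module) subgroup_smult_kernel:
  assumes "a \<in> carrier R"
  shows "subgroup {m \<in> carrier M. a \<odot>\<^bsub>M\<^esub> m = \<zero>\<^bsub>M\<^esub>} (add_monoid M)"
  using group_hom.subgroup_kernel[OF group_hom_smult[OF assms]] by (simp add: kernel_def)

text \<open>One link of the chain: multiplication by \<open>a\<close>, restricted to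
  \<open>b M\<close>, has image \<open>a b M\<close>, and its kernel is the intersection on the
  right.\<close>

lemma (in module) card_smult_image:
  assumes "a \<in> carrier R" "b \<in> carrier R"
  shows "card (smult_image M b) =
    card (smult_image M (a \<otimes> b)) * card ({m \<in> carrier M. a \<odot>\<^bsub>M\<^esub> m = \<zero>\<^bsub>M\<^esub>} \<inter> smult_image M b)"
proof -
  have "(\<lambda>m. a \<odot>\<^bsub>M\<^esub> m) ` smult_image M b = smult_image M (a \<otimes> b)"
    using assms by (simp add: smult_image_def image_image smult_assoc1)
  moreover have "{m \<in> smult_image M b. a \<odot>\<^bsub>M\<^esub> m = \<zero>\<^bsub>M\<^esub>} =
      {m \<in> carrier M. a \<odot>\<^bsub>M\<^esub> m = \<zero>\<^bsub>M\<^esub>} \<inter> smult_image M b"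
    using assms by (auto simp: smult_image_def)
  ultimately show ?thesis
    using comm_group.card_hom_image[OF M.a_comm_group subgroup_smult_image[OF assms(2)] smult_hom[OF assms(1)]]
    by simp
qed

text \<open>\<open>card_smult_image\<close> is iterated downwards from \<open>k = n\<close>, where
  the product is empty and the image is all of \<open>M\<close>. Each step multiplies by one more
  \<open>f k\<close> and splits off the order of the kernel met there.\<close>

lemma (in module) card_carrier_eq_prod:
  fixes f :: "nat \<Rightarrow> 'a" and k n :: nat
  assumes f: "f \<in> {..<n} \<rightarrow> carrier R" and k: "k \<le> n"
  shows "card (carrier M) = card (smult_image M (\<Otimes>j\<in>{k..<n}. f j)) *
    (\<Prod>i\<in>{k..<n}. card ({m \<in> carrier M. f i \<odot>\<^bsub>M\<^esub> m = \<zero>\<^bsub>M\<^esub>} \<inter>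
       smult_image M (\<Otimes>j\<in>{i+1..<n}. f j)))"
  using k
proof (induction k rule: inc_induct)
  case base
  have "smult_image M \<one> = carrier M" by (auto simp: smult_image_def)
  then show ?case by simp
next
  case (step k)
  have fc: "f j \<in> carrier R" if "j < n" for j using f that by auto
  have "{k..<n} = insert k {Suc k..<n}" using step by auto
  moreover from this have "(\<Otimes>j\<in>{k..<n}. f j) = f k \<otimes> (\<Otimes>j\<in>{Suc k..<n}. f j)"
    using fc step by simp
  moreover have "(\<Otimes>j\<in>{Suc k..<n}. f j) \<in> carrier R" using fc by (intro finprod_closed) auto
  ultimately show ?case
    using step fc card_smult_image[of "f k" "\<Otimes>j\<in>{Suc k..<n}. f j"] by simp
qed

section \<open>Arithmetic of monomials in the group ring\<close>

lemma monomial_closed: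
  assumes "cring R" "a \<in> carrier R"
  shows "monomial R G a \<sigma> \<in> carrier (group_ring R G)"
proof -
  interpret R: cring R by fact
  show ?thesis using assms by (auto simp: monomial_def group_ring_def)
qed

text \<open>In the convolution at \<open>\<pi>\<close> only the term \<open>\<mu> = \<sigma>\<close>
  can survive, and it does so exactly if \<open>\<pi>\<close> is the product of
  \<open>\<sigma>\<close> and \<open>\<rho>\<close>.\<close>

lemma monomial_mult:
  assumes "group G" "finite (carrier G)" "cring R"
    and ab: "a \<in> carrier R" "b \<in> carrier R" and sr: "\<sigma> \<in> carrier G" "\<rho> \<in> carrier G"
  shows "monomial R G a \<sigma> \<otimes>\<^bsub>group_ring R G\<^esub> monomial R G b \<rho> =
    monomial R G (a \<otimes>\<^bsub>R\<^esub> b) (\<sigma> \<otimes>\<^bsub>G\<^esub> \<rho>)"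
proof -
  interpret G: group G by fact
  interpret R: cring R by fact
  have "(\<Oplus>\<^bsub>R\<^esub>\<mu>\<in>carrier G. monomial R G a \<sigma> \<mu> \<otimes>\<^bsub>R\<^esub> monomial R G b \<rho> (inv\<^bsub>G\<^esub> \<mu> \<otimes>\<^bsub>G\<^esub> \<pi>))
    = (if \<pi> = \<sigma> \<otimes>\<^bsub>G\<^esub> \<rho> then a \<otimes>\<^bsub>R\<^esub> b else \<zero>\<^bsub>R\<^esub>)" if p: "\<pi> \<in> carrier G" for \<pi>
  proof -
    have "inv\<^bsub>G\<^esub> \<sigma> \<otimes>\<^bsub>G\<^esub> \<pi> = \<rho> \<longleftrightarrow> \<pi> = \<sigma> \<otimes>\<^bsub>G\<^esub> \<rho>"
      using p sr by (metis G.inv_solve_left)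
    then have *: "monomial R G b \<rho> (inv\<^bsub>G\<^esub> \<sigma> \<otimes>\<^bsub>G\<^esub> \<pi>) = (if \<pi> = \<sigma> \<otimes>\<^bsub>G\<^esub> \<rho> then b else \<zero>\<^bsub>R\<^esub>)"
      using p sr by (simp add: monomial_def)
    have "(\<Oplus>\<^bsub>R\<^esub>\<mu>\<in>carrier G. monomial R G a \<sigma> \<mu> \<otimes>\<^bsub>R\<^esub> monomial R G b \<rho> (inv\<^bsub>G\<^esub> \<mu> \<otimes>\<^bsub>G\<^esub> \<pi>))
      = (\<Oplus>\<^bsub>R\<^esub>\<mu>\<in>carrier G. if \<sigma> = \<mu> then a \<otimes>\<^bsub>R\<^esub> monomial R G b \<rho> (inv\<^bsub>G\<^esub> \<mu> \<otimes>\<^bsub>G\<^esub> \<pi>) else \<zero>\<^bsub>R\<^esub>)"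
      using ab p by (intro R.finsum_cong') (auto simp: monomial_def)
    also have "\<dots> = a \<otimes>\<^bsub>R\<^esub> monomial R G b \<rho> (inv\<^bsub>G\<^esub> \<sigma> \<otimes>\<^bsub>G\<^esub> \<pi>)"
      using sr ab p assms(2) by (intro R.finsum_singleton) (auto simp: monomial_def)
    finally show ?thesis using * ab by simp
  qed
  then show ?thesis
    unfolding group_ring_def monomial_def[of R G "a \<otimes>\<^bsub>R\<^esub> b"] by (auto intro: restrict_ext)
qed

lemma monomial_add:
  assumes "cring R"
  shows "monomial R G (a \<oplus>\<^bsub>R\<^esub> b) \<sigma> = monomial R G a \<sigma> \<oplus>\<^bsub>group_ring R G\<^esub> monomial R G b \<sigma>"
proof -
  interpret R: cring R by fact
  show ?thesis by (auto simp: monomial_def group_ring_def intro: restrict_ext)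
qed

lemma scalar_elt_ring_hom:
  assumes "comm_group G" "finite (carrier G)" "cring R"
  shows "scalar_elt R G \<in> ring_hom R (group_ring R G)"
proof -
  interpret G: comm_group G by fact
  show ?thesis
    using assms by (intro ring_hom_memI)
      (auto simp: monomial_closed monomial_mult monomial_add, auto simp: monomial_def group_ring_def)
qed

lemma group_elt_pow:
  assumes "comm_group G" "finite (carrier G)" "cring R" "\<sigma> \<in> carrier G"
  shows "group_elt R G \<sigma> [^]\<^bsub>group_ring R G\<^esub> (k::nat) = group_elt R G (\<sigma> [^]\<^bsub>G\<^esub> k)"
proof (induction k)
  case 0
  then show ?case by (simp add: monomial_def group_ring_def)
next
  case (Suc k)
  interpret G: comm_group G by fact
  interpret R: cring R by fact
  show ?case using assms by (simp add: Suc monomial_mult)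
qed

section \<open>Finite cyclic groups as the powers of a generator\<close>

lemma (in group) bij_betw_nat_pow_generator:
  assumes "finite (carrier G)" "x \<in> carrier G" "generate G {x} = carrier G"
  shows "bij_betw (\<lambda>k::nat. x [^] k) {..<Coset.order G} (carrier G)"
proof -
  have ord: "ord x = Coset.order G"
    using generate_pow_card[OF assms(2)] assms(3) by (simp add: Coset.order_def)
  have "0 < ord x" using ord_ge_1[OF assms(1,2)] by simp
  \<comment> \<open>The facts about \<open>ord\<close> use the closed interval up to
    \<open>ord x - 1\<close>, which is the half-open one because \<open>ord x\<close> is
    positive.\<close>
  then have "{0..ord x - 1} = {..<Coset.order G}" using ord by auto
  then have "inj_on (\<lambda>k::nat. x [^] k) {..<Coset.order G}"
    "(\<lambda>k::nat. x [^] k) ` {..<Coset.order G} = carrier G"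
    using ord_inj[OF assms(2)] ord_elems[OF assms(1,2)]
      generate_pow_on_finite_carrier[OF assms(1,2)] assms(3) by auto
  then show ?thesis by (simp add: bij_betw_def)
qed

text \<open>The theorem assumes only a group with a generator; commutativity is derived here so that
  \<open>group_ring_cring\<close> applies.\<close>

lemma (in group) comm_group_generator:
  assumes "finite (carrier G)" "x \<in> carrier G" "generate G {x} = carrier G"
  shows "comm_group G"
proof (rule group_comm_groupI)
  fix a b assume "a \<in> carrier G" "b \<in> carrier G"
  then obtain i j :: nat where "a = x [^] i" "b = x [^] j"
    using bij_betw_imp_surj_on[OF bij_betw_nat_pow_generator[OF assms]] by blast
  then show "a \<otimes> b = b \<otimes> a" using assms(2) by (simp add: nat_pow_mult add.commute)
qed

section \<open>The cyclic group, its character, and the homomorphisms from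
  \<open>\<int>[\<zeta>]\<close> to \<open>R\<close> and from \<open>R\<close> to
  \<open>R[G]\<close>\<close>

locale cyclic_character =
  fixes G :: "('g, 'd) monoid_scheme" and \<tau> :: 'g and n :: nat
    and R :: "('r, 'c) ring_scheme" and \<zeta> :: complex and h :: "complex \<Rightarrow> 'r"
    and \<chi> :: "'g \<Rightarrow> 'r"
  assumes G: "group G" and finite_G: "finite (carrier G)" and order_G: "Coset.order G = n"
    and gen: "\<tau> \<in> carrier G" "generate G {\<tau>} = carrier G"
    and R: "cring R" and \<zeta>: "primitive_root_of_1 n \<zeta>"
    and h: "h \<in> ring_hom (Z_adjoin \<zeta>) R"
    and \<chi>: "\<chi> \<in> hom G (units_of R)" "\<chi> \<tau> = h \<zeta>"
begin

sublocale G: comm_group G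
  by (rule group.comm_group_generator[OF G finite_G gen])

sublocale R: cring R by (rule R)

abbreviation A where "A \<equiv> group_ring R G"

sublocale A: cring A
  by (rule group_ring_cring[OF G.comm_group_axioms finite_G R])

abbreviation t where "t \<equiv> group_elt R G \<tau>"
abbreviation s where "s \<equiv> scalar_elt R G"
abbreviation z where "z \<equiv> h \<zeta>"

lemma n_pos: "0 < n" and zeta_pow_n: "\<zeta> ^ n = 1"
  using \<zeta> by (auto simp: primitive_root_of_1_def)

sublocale Z: cring "Z_adjoin \<zeta>"
proof -
  interpret C: cring "ring_of_type_algebra :: complex ring"
    by (rule cring_from_type_algebra)
  have "subring (generate_ring (ring_of_type_algebra :: complex ring) {\<zeta>}) ring_of_type_algebra"
    by (rule C.generate_ring_is_subring) (simp add: ring_of_type_algebra_def)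
  then show "cring (Z_adjoin \<zeta>)"
    unfolding Z_adjoin_def
    by (intro C.subcring_iff[THEN iffD1] C.subcringI subringE(1)[of _ "ring_of_type_algebra :: complex ring"])
       (auto simp: ring_of_type_algebra_def)
qed

lemma Z_simps [simp]:
  "x \<otimes>\<^bsub>Z_adjoin \<zeta>\<^esub> y = x * y" "x \<oplus>\<^bsub>Z_adjoin \<zeta>\<^esub> y = x + y"
  "\<one>\<^bsub>Z_adjoin \<zeta>\<^esub> = 1" "\<zero>\<^bsub>Z_adjoin \<zeta>\<^esub> = 0"
  by (auto simp: Z_adjoin_def ring_of_type_algebra_def)

text \<open>Subtraction in \<open>Z_adjoin \<zeta>\<close> is no field of the record: it goes
  through the additive inverse inside the carrier, which \<open>r_neg\<close> identifies with the
  complex one.\<close>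

lemma Z_minus: "x \<in> carrier (Z_adjoin \<zeta>) \<Longrightarrow> y \<in> carrier (Z_adjoin \<zeta>) \<Longrightarrow> x \<ominus>\<^bsub>Z_adjoin \<zeta>\<^esub> y = x - y"
  using Z.r_neg[of y] by (simp add: a_minus_def eq_neg_iff_add_eq_0 add.commute)

lemma Z_pow [simp]: "x [^]\<^bsub>Z_adjoin \<zeta>\<^esub> (k::nat) = x ^ k"
  by (induction k) (auto simp: Z.nat_pow_0)

lemma zeta_in_Z [simp]: "\<zeta> \<in> carrier (Z_adjoin \<zeta>)"
  by (auto simp: Z_adjoin_def intro: generate_ring.incl)

lemma zeta_pow_in_Z [simp]: "\<zeta> ^ k \<in> carrier (Z_adjoin \<zeta>)"
  using Z.nat_pow_closed[OF zeta_in_Z] by simp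

sublocale h: ring_hom_cring "Z_adjoin \<zeta>" R h
  by unfold_locales (rule h)

sublocale s: ring_hom_cring R A s
  by unfold_locales (rule scalar_elt_ring_hom[OF G.comm_group_axioms finite_G R])

lemma z_closed [simp]: "z \<in> carrier R"
  by simp

lemma h_zeta_pow: "h (\<zeta> ^ k) = z [^]\<^bsub>R\<^esub> k"
  using h.ring.hom_nat_pow[OF zeta_in_Z, of k] by simp

lemma z_pow_n: "z [^]\<^bsub>R\<^esub> n = \<one>\<^bsub>R\<^esub>"
  using h_zeta_pow[of n] h.hom_one by (simp add: zeta_pow_n)

lemma t_closed [simp]: "t \<in> carrier A"
  by (simp add: monomial_closed R)

lemma group_elt_tau_pow: "group_elt R G (\<tau> [^]\<^bsub>G\<^esub> (k::nat)) = t [^]\<^bsub>A\<^esub> k"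
  using group_elt_pow[OF G.comm_group_axioms finite_G R gen(1)] by simp

lemma chi_pow: "\<chi> (\<tau> [^]\<^bsub>G\<^esub> (k::nat)) = z [^]\<^bsub>R\<^esub> k"
proof -
  interpret \<chi>: group_hom G "units_of R" \<chi>
    using \<chi>(1) G.is_group R.units_group by (simp add: group_hom_def group_hom_axioms_def)
  have "\<chi> \<tau> \<in> Units R" using \<chi>.hom_closed[OF gen(1)] by (simp add: units_of_carrier)
  then show ?thesis
    using \<chi>.hom_nat_pow[OF gen(1), of k] \<chi>(2) by (simp add: R.units_of_pow)
qed

section \<open>Products of the \<tau> - \<zeta>^j in the group ring, and their relation to
  \<open>eps\<close>\<close>

abbreviation lin where "lin j \<equiv> t \<ominus>\<^bsub>A\<^esub> s (z [^]\<^bsub>R\<^esub> j)"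

lemma h_minus:
  assumes "x \<in> carrier (Z_adjoin \<zeta>)" "y \<in> carrier (Z_adjoin \<zeta>)"
  shows "h (x - y) = h x \<ominus>\<^bsub>R\<^esub> h y"
  using assms h.hom_add[of x "\<ominus>\<^bsub>Z_adjoin \<zeta>\<^esub> y"] Z_minus[of x y]
  by (simp only: a_minus_def h.hom_a_inv Z.a_inv_closed)

text \<open>The polynomial with roots \<zeta>^j is evaluated at \<tau>. Its coefficients travel
  along \<open>s \<circ> h\<close>, with \<open>\<int>[\<zeta>]\<close> as the subring
  \<open>S\<close>, since \<open>h\<close> is a homomorphism only there.\<close>

lemma finprod_lin:
  assumes "finite J"
  shows "(\<Otimes>\<^bsub>A\<^esub>j\<in>J. lin j) =
    (\<Oplus>\<^bsub>A\<^esub>k\<in>{..card J}. s (h (Polynomial.coeff (\<Prod>j\<in>J. [:- (\<zeta> ^ j), 1:]) k)) \<otimes>\<^bsub>A\<^esub> t [^]\<^bsub>A\<^esub> k)"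
proof -
  have "(\<Otimes>\<^bsub>A\<^esub>j\<in>J. t \<ominus>\<^bsub>A\<^esub> (s \<circ> h) (\<zeta> ^ j)) =
    (\<Oplus>\<^bsub>A\<^esub>k\<in>{..card J}. (s \<circ> h) (Polynomial.coeff (\<Prod>j\<in>J. [:- (\<zeta> ^ j), 1:]) k) \<otimes>\<^bsub>A\<^esub> t [^]\<^bsub>A\<^esub> k)"
  proof (rule A.finprod_linear_factors[where S = "carrier (Z_adjoin \<zeta>)"
        and \<phi> = "s \<circ> h" and c = "\<lambda>j. \<zeta> ^ j"])
    show "1 \<in> carrier (Z_adjoin \<zeta>)" using Z.one_closed by simp
    show "x - y \<in> carrier (Z_adjoin \<zeta>) \<and> x * y \<in> carrier (Z_adjoin \<zeta>)"
      if "x \<in> carrier (Z_adjoin \<zeta>)" "y \<in> carrier (Z_adjoin \<zeta>)" for x y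
      using that Z.minus_closed[OF that] Z.m_closed[OF that] by (simp add: Z_minus)
    show "(s \<circ> h) 1 = \<one>\<^bsub>A\<^esub>" using h.hom_one s.hom_one by simp
    show "(s \<circ> h) (x - y) = (s \<circ> h) x \<ominus>\<^bsub>A\<^esub> (s \<circ> h) y \<and> (s \<circ> h) (x * y) = (s \<circ> h) x \<otimes>\<^bsub>A\<^esub> (s \<circ> h) y"
      if "x \<in> carrier (Z_adjoin \<zeta>)" "y \<in> carrier (Z_adjoin \<zeta>)" for x y
      using that h.hom_mult[OF that] by (simp add: h_minus a_minus_def)
  qed (use assms in auto)
  then show ?thesis by (simp add: h_zeta_pow)
qed

text \<open>The product is \<open>X^n - 1\<close> evaluated at \<tau>, and \<tau> has order dividing
  \<open>n\<close>.\<close>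

lemma finprod_lin_all: "(\<Otimes>\<^bsub>A\<^esub>j\<in>{..<n}. lin j) = \<zero>\<^bsub>A\<^esub>"
proof -
  have tn: "t [^]\<^bsub>A\<^esub> n = \<one>\<^bsub>A\<^esub>"
    using group_elt_tau_pow[of n] G.pow_order_eq_1[OF gen(1)] s.hom_one by (simp add: order_G)
  have h1: "h 1 = \<one>\<^bsub>R\<^esub>" and h0: "h 0 = \<zero>\<^bsub>R\<^esub>" using h.hom_one h.hom_zero by simp_all
  have hm1: "h (-1) = \<ominus>\<^bsub>R\<^esub> \<one>\<^bsub>R\<^esub>"
    using h_minus[of 0 1] Z.one_closed Z.zero_closed by (simp add: h0 h1 R.minus_eq)
  \<comment> \<open>The only nonzero coefficients of \<open>X^n - 1\<close> are at \<open>n\<close>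
    and at \<open>0\<close>, which are different indices because \<open>n\<close> is
    positive.\<close>
  have "(\<Otimes>\<^bsub>A\<^esub>j\<in>{..<n}. lin j) =
    (\<Oplus>\<^bsub>A\<^esub>k\<in>{..n}. (if n = k then t [^]\<^bsub>A\<^esub> k else \<zero>\<^bsub>A\<^esub>) \<oplus>\<^bsub>A\<^esub> (if 0 = k then \<ominus>\<^bsub>A\<^esub> \<one>\<^bsub>A\<^esub> else \<zero>\<^bsub>A\<^esub>))"
    unfolding finprod_lin[OF finite_lessThan] prod_roots_of_1[OF \<zeta>] using n_pos
    by (intro A.finsum_cong') (auto simp: h0 h1 hm1)
  also have "\<dots> = t [^]\<^bsub>A\<^esub> n \<oplus>\<^bsub>A\<^esub> \<ominus>\<^bsub>A\<^esub> \<one>\<^bsub>A\<^esub>"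
    using A.finsum_singleton[of n "{..n}" "\<lambda>k. t [^]\<^bsub>A\<^esub> k"]
      A.finsum_singleton[of 0 "{..n}" "\<lambda>k. \<ominus>\<^bsub>A\<^esub> \<one>\<^bsub>A\<^esub>"]
    by (subst A.finsum_addf) auto
  finally show ?thesis by (simp add: tn A.r_neg)
qed

lemma finprod_lin_remove:
  assumes "i < n"
  shows "(\<Otimes>\<^bsub>A\<^esub>j\<in>{..<n}-{i}. lin j) =
    (\<Oplus>\<^bsub>A\<^esub>k\<in>{..<n}. s (z [^]\<^bsub>R\<^esub> (i * (n - Suc k))) \<otimes>\<^bsub>A\<^esub> t [^]\<^bsub>A\<^esub> k)"
proof -
  \<comment> \<open>There are \<open>n - 1\<close> factors, so the exponents up to that number are
    those below \<open>n\<close>.\<close>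
  have card: "{..card ({..<n} - {i})} = {..<n}" using assms by auto
  have "Polynomial.coeff (\<Sum>k<n. monom (\<zeta> ^ (i * (n - Suc k))) k) k = \<zeta> ^ (i * (n - Suc k))"
    if "k < n" for k
    using that by (simp add: coeff_sum)
  then show ?thesis
    unfolding finprod_lin[OF finite_Diff[OF finite_lessThan]] prod_roots_of_1_remove[OF \<zeta> assms] card
    by (intro A.finsum_cong') (auto simp: h_zeta_pow)
qed

text \<open>The inverse of \<zeta>^(ik) is \<zeta>^(i(n-k)). One factor \<zeta>^i is split off so
  that the rest is the coefficient in \<open>finprod_lin_remove\<close>.\<close>

lemma inv_char_power:
  assumes "k < n"
  shows "inv\<^bsub>R\<^esub> (char_power R \<chi> i (\<tau> [^]\<^bsub>G\<^esub> k)) = z [^]\<^bsub>R\<^esub> i \<otimes>\<^bsub>R\<^esub> z [^]\<^bsub>R\<^esub> (i * (n - Suc k))"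
proof -
  have "char_power R \<chi> i (\<tau> [^]\<^bsub>G\<^esub> k) \<otimes>\<^bsub>R\<^esub> (z [^]\<^bsub>R\<^esub> i \<otimes>\<^bsub>R\<^esub> z [^]\<^bsub>R\<^esub> (i * (n - Suc k)))
    = z [^]\<^bsub>R\<^esub> (k * i + (i + i * (n - Suc k)))"
    by (simp add: char_power_def chi_pow R.nat_pow_pow R.nat_pow_mult)
  \<comment> \<open>As \<open>k < n\<close>, the truncated difference is exact and
    \<open>k + 1 + (n - Suc k) = n\<close>.\<close>
  also have "k * i + (i + i * (n - Suc k)) = n * i"
    using assms by (auto simp: algebra_simps simp flip: add_mult_distrib2 dest!: less_imp_Suc_add)
  also have "z [^]\<^bsub>R\<^esub> (n * i) = \<one>\<^bsub>R\<^esub>"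
    by (simp add: z_pow_n flip: R.nat_pow_pow)
  finally show ?thesis
    by (intro R.comm_inv_char) (auto simp: char_power_def chi_pow)
qed

text \<open>The sum over \<open>G\<close> is reindexed by the powers of \<tau>. With \<zeta>^i taken
  out, it is the quotient of \<open>X^n - 1\<close> by \<open>X - \<zeta>^i\<close>, evaluated at
  \<tau>.\<close>

lemma eps_eq:
  assumes "i < n"
  shows "eps R G (char_power R \<chi> i) = s (z [^]\<^bsub>R\<^esub> i) \<otimes>\<^bsub>A\<^esub> (\<Otimes>\<^bsub>A\<^esub>j\<in>{..<n}-{i}. lin j)"
proof -
  let ?a = "\<lambda>k. z [^]\<^bsub>R\<^esub> i \<otimes>\<^bsub>R\<^esub> z [^]\<^bsub>R\<^esub> (i * (n - Suc k))"
  let ?m = "\<lambda>\<sigma>. monomial R G (inv\<^bsub>R\<^esub> (char_power R \<chi> i \<sigma>)) \<sigma>"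
  have bij: "bij_betw (\<lambda>k::nat. \<tau> [^]\<^bsub>G\<^esub> k) {..<n} (carrier G)"
    using G.bij_betw_nat_pow_generator[OF finite_G gen] by (simp add: order_G)
  have m: "?m (\<tau> [^]\<^bsub>G\<^esub> k) = s (z [^]\<^bsub>R\<^esub> i) \<otimes>\<^bsub>A\<^esub> (s (z [^]\<^bsub>R\<^esub> (i * (n - Suc k))) \<otimes>\<^bsub>A\<^esub> t [^]\<^bsub>A\<^esub> k)"
    if "k < n" for k
  proof -
    have "?m (\<tau> [^]\<^bsub>G\<^esub> k) = s (?a k) \<otimes>\<^bsub>A\<^esub> t [^]\<^bsub>A\<^esub> k"
      using that gen(1)
      by (simp add: inv_char_power monomial_mult[OF G finite_G R] del: s.ring.hom_nat_pow s.hom_mult flip: group_elt_tau_pow)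
    then show ?thesis by (simp add: A.m_assoc del: s.ring.hom_nat_pow)
  qed
  have "eps R G (char_power R \<chi> i) = (\<Oplus>\<^bsub>A\<^esub>\<sigma>\<in>(\<lambda>k::nat. \<tau> [^]\<^bsub>G\<^esub> k) ` {..<n}. ?m \<sigma>)"
    using bij by (simp add: eps_def bij_betw_def)
  also have "\<dots> = (\<Oplus>\<^bsub>A\<^esub>k\<in>{..<n}. ?m (\<tau> [^]\<^bsub>G\<^esub> k))"
  proof (rule A.finsum_reindex)
    show "?m \<in> (\<lambda>k::nat. \<tau> [^]\<^bsub>G\<^esub> k) ` {..<n} \<rightarrow> carrier A" using m by auto
  qed (use bij in \<open>simp add: bij_betw_def\<close>)
  also have "\<dots> = (\<Oplus>\<^bsub>A\<^esub>k\<in>{..<n}. s (z [^]\<^bsub>R\<^esub> i) \<otimes>\<^bsub>A\<^esub> (s (z [^]\<^bsub>R\<^esub> (i * (n - Suc k))) \<otimes>\<^bsub>A\<^esub> t [^]\<^bsub>A\<^esub> k))"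
    using m by (intro A.finsum_cong') auto
  also have "\<dots> = s (z [^]\<^bsub>R\<^esub> i) \<otimes>\<^bsub>A\<^esub> (\<Otimes>\<^bsub>A\<^esub>j\<in>{..<n}-{i}. lin j)"
    unfolding finprod_lin_remove[OF assms] by (rule A.finsum_rdistr[symmetric]) auto
  finally show ?thesis .
qed

lemma tail_prod_eq: "tail_prod R G \<tau> z i = (\<Otimes>\<^bsub>A\<^esub>j\<in>{i+1..<n}. lin j)"
  by (simp add: tail_prod_def order_G)

text \<open>The factor \<open>lin i\<close> is the one missing from \<open>eps\<close>; supplying it
  completes the product that vanishes. Hence the image of \<open>eps\<close> lies in the kernel of
  \<open>lin i\<close>.\<close>

lemma lin_mult_eps:
  assumes "i < n"
  shows "lin i \<otimes>\<^bsub>A\<^esub> eps R G (char_power R \<chi> i) = \<zero>\<^bsub>A\<^esub>"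
proof -
  have "(\<Otimes>\<^bsub>A\<^esub>j\<in>insert i ({..<n}-{i}). lin j) = lin i \<otimes>\<^bsub>A\<^esub> (\<Otimes>\<^bsub>A\<^esub>j\<in>{..<n}-{i}. lin j)"
    by (rule A.finprod_insert) auto
  moreover have "insert i ({..<n}-{i}) = {..<n}" using assms by auto
  ultimately have *: "lin i \<otimes>\<^bsub>A\<^esub> (\<Otimes>\<^bsub>A\<^esub>j\<in>{..<n}-{i}. lin j) = \<zero>\<^bsub>A\<^esub>"
    by (simp only: finprod_lin_all)
  have c: "lin i \<in> carrier A" "s (z [^]\<^bsub>R\<^esub> i) \<in> carrier A" "(\<Otimes>\<^bsub>A\<^esub>j\<in>{..<n}-{i}. lin j) \<in> carrier A"
    by (auto intro!: A.finprod_closed)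
  have "lin i \<otimes>\<^bsub>A\<^esub> eps R G (char_power R \<chi> i)
    = s (z [^]\<^bsub>R\<^esub> i) \<otimes>\<^bsub>A\<^esub> (lin i \<otimes>\<^bsub>A\<^esub> (\<Otimes>\<^bsub>A\<^esub>j\<in>{..<n}-{i}. lin j))"
    unfolding eps_eq[OF assms] using c by (rule A.m_lcomm)
  then show ?thesis unfolding * using c by (simp only: A.r_null)
qed

text \<open>The cofactor consists of \<zeta>^i and the factors with \<open>j < i\<close>. It stands
  on the right, so that applying \<open>eps\<close> to \<open>m\<close> is applying
  \<open>tail_prod\<close> to \<open>b\<close> times \<open>m\<close>.\<close>

lemma eps_factor_tail_prod:
  assumes "i < n"
  obtains b where "b \<in> carrier A" "eps R G (char_power R \<chi> i) = tail_prod R G \<tau> z i \<otimes>\<^bsub>A\<^esub> b"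
proof
  let ?b = "s (z [^]\<^bsub>R\<^esub> i) \<otimes>\<^bsub>A\<^esub> (\<Otimes>\<^bsub>A\<^esub>j\<in>{..<i}. lin j)"
  show "?b \<in> carrier A" by (auto intro!: A.finprod_closed)
  have "{..<n} - {i} = {..<i} \<union> {i+1..<n}" using assms by auto
  moreover have "(\<Otimes>\<^bsub>A\<^esub>j\<in>{..<i} \<union> {i+1..<n}. lin j) =
      (\<Otimes>\<^bsub>A\<^esub>j\<in>{..<i}. lin j) \<otimes>\<^bsub>A\<^esub> (\<Otimes>\<^bsub>A\<^esub>j\<in>{i+1..<n}. lin j)"
    by (rule A.finprod_Un_disjoint) auto
  ultimately have eq: "eps R G (char_power R \<chi> i) =
      s (z [^]\<^bsub>R\<^esub> i) \<otimes>\<^bsub>A\<^esub> ((\<Otimes>\<^bsub>A\<^esub>j\<in>{..<i}. lin j) \<otimes>\<^bsub>A\<^esub> (\<Otimes>\<^bsub>A\<^esub>j\<in>{i+1..<n}. lin j))"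
    by (simp only: eps_eq[OF assms])
  have swap: "a \<otimes>\<^bsub>A\<^esub> (b \<otimes>\<^bsub>A\<^esub> c) = c \<otimes>\<^bsub>A\<^esub> (a \<otimes>\<^bsub>A\<^esub> b)"
    if "a \<in> carrier A" "b \<in> carrier A" "c \<in> carrier A" for a b c
    using that by (simp add: A.m_ac)
  show "eps R G (char_power R \<chi> i) = tail_prod R G \<tau> z i \<otimes>\<^bsub>A\<^esub> ?b"
    unfolding eq tail_prod_eq by (rule swap) (auto intro!: A.finprod_closed)
qed

lemma eps_closed: "i < n \<Longrightarrow> eps R G (char_power R \<chi> i) \<in> carrier A"
  unfolding eps_eq by (auto intro!: A.finprod_closed)

lemma tail_prod_closed: "tail_prod R G \<tau> z i \<in> carrier A"
  unfolding tail_prod_eq by (auto intro!: A.finprod_closed)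

section \<open>Character parts as kernels, and the image of \<open>eps\<close>\<close>

text \<open>Every element of \<open>G\<close> is a power of \<tau>, so the condition at \<tau> alone
  suffices. This identifies the character parts with the kernels that occur in
  \<open>card_carrier_eq_prod\<close>.\<close>

lemma char_part_eq:
  assumes "module A M"
  shows "char_part R G M (char_power R \<chi> i) = {m \<in> carrier M. lin i \<odot>\<^bsub>M\<^esub> m = \<zero>\<^bsub>M\<^esub>}"
proof -
  interpret M: module A M by fact
  have "(\<forall>\<sigma>\<in>carrier G. group_elt R G \<sigma> \<odot>\<^bsub>M\<^esub> m = s (char_power R \<chi> i \<sigma>) \<odot>\<^bsub>M\<^esub> m)
      \<longleftrightarrow> t \<odot>\<^bsub>M\<^esub> m = s (z [^]\<^bsub>R\<^esub> i) \<odot>\<^bsub>M\<^esub> m" if m: "m \<in> carrier M" for m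
  proof
    assume "\<forall>\<sigma>\<in>carrier G. group_elt R G \<sigma> \<odot>\<^bsub>M\<^esub> m = s (char_power R \<chi> i \<sigma>) \<odot>\<^bsub>M\<^esub> m"
    then show "t \<odot>\<^bsub>M\<^esub> m = s (z [^]\<^bsub>R\<^esub> i) \<odot>\<^bsub>M\<^esub> m"
      using gen(1) \<chi>(2) by (auto simp: char_power_def)
  next
    assume eq: "t \<odot>\<^bsub>M\<^esub> m = s (z [^]\<^bsub>R\<^esub> i) \<odot>\<^bsub>M\<^esub> m"
    show "\<forall>\<sigma>\<in>carrier G. group_elt R G \<sigma> \<odot>\<^bsub>M\<^esub> m = s (char_power R \<chi> i \<sigma>) \<odot>\<^bsub>M\<^esub> m"
    proof
      fix \<sigma> assume "\<sigma> \<in> carrier G"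
      then obtain k :: nat where k: "\<sigma> = \<tau> [^]\<^bsub>G\<^esub> k"
        using bij_betw_imp_surj_on[OF G.bij_betw_nat_pow_generator[OF finite_G gen]] by blast
      \<comment> \<open>The exponents are swapped so that both sides become \<open>k\<close>-th
        powers of the elements compared in \<open>eq\<close>.\<close>
      have "char_power R \<chi> i \<sigma> = (z [^]\<^bsub>R\<^esub> i) [^]\<^bsub>R\<^esub> k"
        by (simp add: char_power_def k chi_pow R.nat_pow_pow mult.commute)
      moreover have "s ((z [^]\<^bsub>R\<^esub> i) [^]\<^bsub>R\<^esub> k) = s (z [^]\<^bsub>R\<^esub> i) [^]\<^bsub>A\<^esub> k"
        by (rule s.ring.hom_nat_pow) simp
      moreover have "t [^]\<^bsub>A\<^esub> k \<odot>\<^bsub>M\<^esub> m = s (z [^]\<^bsub>R\<^esub> i) [^]\<^bsub>A\<^esub> k \<odot>\<^bsub>M\<^esub> m"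
        using m eq by (intro M.nat_pow_smult_eq) auto
      ultimately show "group_elt R G \<sigma> \<odot>\<^bsub>M\<^esub> m = s (char_power R \<chi> i \<sigma>) \<odot>\<^bsub>M\<^esub> m"
        by (simp only: k group_elt_tau_pow)
    qed
  qed
  then show ?thesis
    unfolding char_part_def by (intro Collect_cong conj_cong refl) (simp add: M.minus_smult_eq_zero_iff)
qed

text \<open>The inclusion needed for \<open>tate_S\<close> to be a genuine quotient:
  \<open>lin_mult_eps\<close> gives the first component and \<open>eps_factor_tail_prod\<close> the
  second.\<close>

lemma eps_image_subset:
  assumes "module A M" "i < n"
  shows "smult_image M (eps R G (char_power R \<chi> i)) \<subseteq>
    char_part R G M (char_power R \<chi> i) \<inter> smult_image M (tail_prod R G \<tau> z i)"
proof -
  interpret M: module A M by fact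
  obtain b where b: "b \<in> carrier A" "eps R G (char_power R \<chi> i) = tail_prod R G \<tau> z i \<otimes>\<^bsub>A\<^esub> b"
    using eps_factor_tail_prod[OF assms(2)] .
  have "lin i \<odot>\<^bsub>M\<^esub> (eps R G (char_power R \<chi> i) \<odot>\<^bsub>M\<^esub> m) = \<zero>\<^bsub>M\<^esub>" if "m \<in> carrier M" for m
    using that eps_closed[OF assms(2)] lin_mult_eps[OF assms(2)]
    by (subst M.smult_assoc1[symmetric]) auto
  moreover have "eps R G (char_power R \<chi> i) \<odot>\<^bsub>M\<^esub> m \<in> smult_image M (tail_prod R G \<tau> z i)"
    if "m \<in> carrier M" for m
    using that b tail_prod_closed by (auto simp: smult_image_def M.smult_assoc1)
  ultimately show ?thesis
    using eps_closed[OF assms(2)] unfolding char_part_eq[OF assms(1)]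
    by (auto simp: smult_image_def[of M "eps R G (char_power R \<chi> i)"])
qed

end

section \<open>The two formulas for the order of the module\<close>

theorem theorem2p2:
  fixes G :: "('g, 'd) monoid_scheme"
    and \<tau> :: 'g
    and n :: nat
    and R :: "('r, 'c) ring_scheme"
    and \<zeta> :: complex
    and h :: "complex \<Rightarrow> 'r"
    and \<chi> :: "'g \<Rightarrow> 'r"
    and M :: "('g \<Rightarrow> 'r, 'm, 'z) module_scheme"
  assumes "group G" and "finite (carrier G)" and "Coset.order G = n"
    and "\<tau> \<in> carrier G" and "generate G {\<tau>} = carrier G"
    and "cring R"
    and "primitive_root_of_1 n \<zeta>"
    and "h \<in> ring_hom (Z_adjoin \<zeta>) R"
    and "\<chi> \<in> hom G (units_of R)" and "\<chi> \<tau> = h \<zeta>"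
    and "module (group_ring R G) M" and "finite (carrier M)"
  shows
    "Coset.order M *
       (\<Prod>i<n. Coset.order (tate_H0 R G M (char_power R \<chi> i)
                  Mod carrier (tate_S R G M \<tau> (h \<zeta>) \<chi> i)))
       = (\<Prod>i<n. card (char_part R G M (char_power R \<chi> i)))
     \<and> Coset.order M =
       (\<Prod>i<n. card (smult_image M (eps R G (char_power R \<chi> i)))) *
       (\<Prod>i<n. Coset.order (tate_S R G M \<tau> (h \<zeta>) \<chi> i))"
proof -
  interpret cyclic_character G \<tau> n R \<zeta> h \<chi>
    by (rule cyclic_character.intro) (fact assms)+
  interpret M: module A M by fact
  let ?C = "\<lambda>i. char_part R G M (char_power R \<chi> i)"
  let ?E = "\<lambda>i. smult_image M (eps R G (char_power R \<chi> i))"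
  let ?K = "\<lambda>i. ?C i \<inter> smult_image M (tail_prod R G \<tau> z i)"
  let ?H0 = "\<lambda>i. tate_H0 R G M (char_power R \<chi> i)"
  let ?S = "\<lambda>i. tate_S R G M \<tau> z \<chi> i"
  \<comment> \<open>An \<open>A_Mod\<close> quotient is the \<open>Mod\<close> quotient of the
    additive group, so the facts about abelian groups in multiplicative notation apply.\<close>
  have AM: "(M\<lparr>carrier := B\<rparr>) A_Mod D = (add_monoid M)\<lparr>carrier := B\<rparr> Mod D" for B D
    by (simp add: A_FactGroup_def)
  have sub: "subgroup (?E i) (add_monoid M)" "subgroup (?C i) (add_monoid M)"
    "subgroup (?K i) (add_monoid M)" if "i < n" for i
    using M.subgroup_smult_image[OF eps_closed[OF that]]
      M.subgroup_smult_image[OF tail_prod_closed] M.subgroup_smult_kernel[of "lin i"]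
    by (auto simp: char_part_eq[OF assms(11)] intro: group.subgroups_Inter_pair[OF M.a_group])
  note EK = eps_image_subset[OF assms(11)]
  \<comment> \<open>The next three facts are Lagrange's theorem along the chain
    \<open>?E i \<subseteq> ?K i \<subseteq> ?C i\<close> of subgroups of \<open>M\<close>.\<close>
  have S: "Coset.order (?S i) * card (?E i) = card (?K i)" if "i < n" for i
    unfolding tate_S_def AM by (rule comm_group.order_subgroup_Mod[OF M.a_comm_group]) (use sub EK that in auto)
  have H0: "Coset.order (?H0 i) * card (?E i) = card (?C i)" if "i < n" for i
    unfolding tate_H0_def AM by (rule comm_group.order_subgroup_Mod[OF M.a_comm_group]) (use sub EK that in auto)
  have HS: "Coset.order (?H0 i Mod carrier (?S i)) * Coset.order (?S i) = Coset.order (?H0 i)"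
    if "i < n" for i
    unfolding tate_H0_def tate_S_def AM
    by (rule comm_group.order_subgroup_Mod_Mod[OF M.a_comm_group]) (use sub EK that in auto)
  \<comment> \<open>At \<open>k = 0\<close> the remaining image in
    \<open>card_carrier_eq_prod\<close> is that of the zero element, so it contributes the factor
    \<open>1\<close>.\<close>
  have "smult_image M \<zero>\<^bsub>A\<^esub> = {\<zero>\<^bsub>M\<^esub>}"
    using M.M.zero_closed by (auto simp: smult_image_def)
  then have "card (carrier M) = (\<Prod>i<n. card (?K i))"
    using M.card_carrier_eq_prod[of lin n 0] finprod_lin_all
    by (simp add: atLeast0LessThan char_part_eq[OF assms(11)] tail_prod_eq)
  also have "\<dots> = (\<Prod>i<n. card (?E i) * Coset.order (?S i))"
    by (rule prod.cong) (use S in \<open>auto simp: mult.commute\<close>)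
  finally have M: "Coset.order M = (\<Prod>i<n. card (?E i)) * (\<Prod>i<n. Coset.order (?S i))"
    by (simp add: Coset.order_def prod.distrib)
  \<comment> \<open>The first formula follows from the second: each \<open>?C i\<close> exceeds
    \<open>?K i\<close> in order by the factor \<open>[?H0 i / ?S i]\<close>.\<close>
  have "(\<Prod>i<n. card (?C i)) =
      (\<Prod>i<n. card (?E i) * Coset.order (?S i) * Coset.order (?H0 i Mod carrier (?S i)))"
    by (rule prod.cong) (simp_all flip: H0 HS)
  with M show ?thesis by (simp add: prod.distrib)
qed

end
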